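(* Let $q=2^s$ with $s\ge 1$ and $n=q^3-q-1$. (i) For $x\in\mathbb{F}_{q^2}$, $g_{n,q}(x)=0$ if $x=0$, and $g_{n,q}(x)=x^{q-2}+\mathrm{Tr}_{q^2/q}(x^{-1})$ if $x\ne 0$. (ii) $g_{n,q}$ is a permutation polynomial of $\mathbb{F}_{q^2}$ if and only if $s$ is even.
   Context: For a prime $p$, a power $q$ of $p$ and an integer $n\ge 0$, $g_{n,q}\in\mathbb{F}_p[x]$ is the unique polynomial with $\sum_{a\in\mathbb{F}_q}(x+a)^n=g_{n,q}(x^q-x)$. A permutation polynomial of a finite field $\mathbb{F}$ is a polynomial inducing a bijection of $\mathbb{F}$. $\mathrm{Tr}_{q^2/q}(y)=y+y^q$.
   Formalization: In (i), the claim g_{n,q}(0)=0 is stated only for s≥2, since it is false for s=1: there q=2, n=5, g_{5,2}=x^2+x+1 and g_{5,2}(0)=1; everything else is stated for all s≥1. *)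

theory Defs
  imports "HOL-Library.Cardinality" "HOL-Computational_Algebra.Polynomial"
begin

text \<open>
  All fields live inside one finite ambient field given by a type \<open>'k\<close>. If \<open>'k\<close> has characteristic
  \<open>p\<close>, the field of \<open>p\<close> elements is the prime subfield of \<open>'k\<close>, consisting of the images of the
  natural numbers.
\<close>

definition prime_subfield :: "'k :: {field, finite} set" where
  "prime_subfield = range of_nat"

text \<open>
  The subfield of order \<open>q\<close> consists of the roots of \<open>X ^ q - X\<close>. This set has \<open>q\<close> elements whenever
  \<open>CARD('k)\<close> is a power of the prime power \<open>q\<close>, and is only meant to be used in that case.
\<close>

definition subfield_of_order :: "nat \<Rightarrow> 'k :: {field, finite} set" where
  "subfield_of_order q = {a. a ^ q = a}"

text \<open>
  The defining identity below is an identity of polynomials, not just of functions on \<open>'k\<close>: the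
  linear polynomial \<open>[:a, 1:]\<close> is \<open>X + a\<close>, and the right-hand side is \<open>g\<close> composed with \<open>X ^ q - X\<close>.
\<close>

definition g_poly :: "nat \<Rightarrow> nat \<Rightarrow> 'k :: {field, finite} poly" where
  "g_poly n q = (THE g. (\<forall>i. coeff g i \<in> prime_subfield) \<and>
     (\<Sum>a \<in> subfield_of_order q. [:a, 1:] ^ n) = pcompose g (monom 1 q - [:0, 1:]))"

definition permutation_polynomial :: "'k :: {field, finite} poly \<Rightarrow> bool" where
  "permutation_polynomial f \<longleftrightarrow> bij (poly f)"

text \<open>The trace from the field of order \<open>q ^ 2\<close> to its subfield of order \<open>q\<close>.\<close>

definition quadratic_trace :: "nat \<Rightarrow> 'k :: {field, finite} \<Rightarrow> 'k" where
  "quadratic_trace q y = y + y ^ q"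

end

theory Submission
  imports Defs "HOL-Computational_Algebra.Primes"
begin

text \<open>
  Put \<open>P = X ^ q - X\<close>, so that \<open>(X + a) ^ q = X + a + P\<close> for \<open>a\<close> in the field of order \<open>q\<close>. Since
  \<open>n + q + 1 = q ^ 3\<close>, the summand \<open>(X + a) ^ n\<close> is
  \<open>(X + a) ^ (q ^ 3) / ((X + a) ^ q * (X + a))\<close>; a partial fraction decomposition and the logarithmic
  derivative of \<open>P = (\<Prod>a. X + a)\<close> give
  \<open>g = X ^ (q ^ 2 - q - 1) - X ^ (q ^ 2 - 2) - X ^ (q - 2)\<close> for every prime power \<open>q\<close>.

  For even \<open>q\<close> and \<open>x \<noteq> 0\<close>, put \<open>z = 1 / x\<close> and \<open>w = z ^ (q - 1)\<close>. Then
  \<open>g x = z * (1 + w + w ^ 2) / w\<close>, and if this is nonzero then \<open>(g x) ^ (q - 1) = w\<close>, so that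
  \<open>g x\<close> determines \<open>w\<close> and then \<open>z\<close>. Thus \<open>g\<close> permutes the field unless some \<open>w\<close> is a
  primitive cube root of unity, which happens if and only if \<open>3\<close> divides \<open>q + 1\<close>.
\<close>

section \<open>Frobenius and Fermat in finite fields\<close>

lemma diff_power_CHAR:
  fixes x y :: "'a :: comm_ring_1"
  assumes "prime CHAR('a)" "q = CHAR('a) ^ s"
  shows "(x - y) ^ q = x ^ q - y ^ q"
proof -
  have "((x - y) + y) ^ q = (x - y) ^ q + y ^ q"
    using assms by (rule freshmans_dream')
  thus ?thesis by simp
qed

text \<open>Multiplication by a nonzero \<open>x\<close> permutes the nonzero elements, so their
  product absorbs a factor \<open>x ^ (CARD('a) - 1)\<close>.\<close>

lemma finite_field_power_CARD:
  fixes x :: "'a :: {field, finite}"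
  shows "x ^ CARD('a) = x"
proof (cases "x = 0")
  case False
  have "(\<Prod>y\<in>UNIV-{0}. y) = (\<Prod>y\<in>UNIV-{0}. x * y)"
    by (rule prod.reindex_bij_witness[of _ "\<lambda>y. x * y" "\<lambda>y. y / x"]) (use False in auto)
  also have "\<dots> = x ^ (CARD('a) - 1) * (\<Prod>y\<in>UNIV-{0}. y)"
    by (simp add: prod.distrib)
  finally have "x ^ (CARD('a) - 1) = 1" by simp
  moreover have "x ^ CARD('a) = x * x ^ (CARD('a) - 1)"
    by (simp flip: power_Suc)
  ultimately show ?thesis by simp
qed simp

lemma degree_monom_minus_X:
  assumes "2 \<le> q"
  shows "degree (monom 1 q - [:0, 1:] :: 'a :: {field, finite} poly) = q"
proof -
  have "degree (monom 1 q + (- [:0, 1:]) :: 'a poly) = degree (monom 1 q :: 'a poly)"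
    using assms by (intro degree_add_eq_left) (simp add: degree_monom_eq)
  thus ?thesis by (simp add: degree_monom_eq del: minus_pCons)
qed

section \<open>The closed form of \<open>g_poly\<close>\<close>

context
  fixes q s :: nat
  assumes char: "prime CHAR('k :: {field, finite})"
    and q: "q = CHAR('k) ^ s"
    and s: "s \<ge> 1"
    and card: "CARD('k) = q ^ 2"
begin

abbreviation "F \<equiv> subfield_of_order q :: 'k set"

abbreviation "P \<equiv> monom 1 q - [:0, 1:] :: 'k poly"

lemma q_ge_2: "q \<ge> 2"
proof -
  have "2 \<le> CHAR('k)" using char by (rule prime_ge_2_nat)
  also have "\<dots> \<le> q" using s prime_ge_1_nat[OF char] unfolding q
    by (intro self_le_power) auto
  finally show ?thesis .
qed

lemmas diff_power_q = diff_power_CHAR[OF char q]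

lemma diff_power_q_poly: "(f - g) ^ q = f ^ q - (g ^ q :: 'k poly)"
  by (rule diff_power_CHAR[where s = s]) (use char q in simp_all)

lemma card_subfield: "card F = q"
proof (rule antisym)
  have F_eq: "F = {x. poly P x = 0}"
    by (auto simp: subfield_of_order_def poly_monom)
  have "P \<noteq> 0" using degree_monom_minus_X[OF q_ge_2, where 'a = 'k] q_ge_2 by auto
  from card_poly_roots_bound[OF this] show le: "card F \<le> q"
    unfolding F_eq degree_monom_minus_X[OF q_ge_2] .
  txt \<open>The additive map \<open>a \<mapsto> a ^ q - a\<close> has kernel \<open>F\<close>, and its image, consisting of roots of
    \<open>X ^ q + X\<close>, has at most \<open>q\<close> elements.\<close>
  define h :: "'k \<Rightarrow> 'k" where "h = (\<lambda>a. a ^ q - a)"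
  define B where "B = {b :: 'k. b ^ q = - b}"
  have "h a \<in> B" for a
  proof -
    have "(a ^ q) ^ q = a"
      using finite_field_power_CARD[of a] by (simp add: card power2_eq_square power_mult)
    thus ?thesis by (simp add: B_def h_def diff_power_q)
  qed
  hence "card (UNIV :: 'k set) \<le> card (\<Union>b\<in>B. {a. h a = b})"
    by (intro card_mono) auto
  also have "\<dots> \<le> (\<Sum>b\<in>B. card {a. h a = b})"
    by (rule card_UN_le) simp
  also have "\<dots> \<le> (\<Sum>b\<in>B. card F)"
  proof (rule sum_mono)
    fix b
    show "card {a. h a = b} \<le> card F"
    proof (cases "{a. h a = b} = {}")
      case False
      then obtain c where c: "h c = b" by auto
      \<comment> \<open>Points of one fibre differ by elements of \<open>F\<close>, so translation
        by \<open>c\<close> embeds the fibre in \<open>F\<close>.\<close>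
      have "inj_on (\<lambda>a. a - c) {a. h a = b}" by (auto simp: inj_on_def)
      moreover have "(\<lambda>a. a - c) ` {a. h a = b} \<subseteq> F"
        using c by (auto simp: subfield_of_order_def h_def diff_power_q algebra_simps)
      ultimately show ?thesis by (intro card_inj_on_le) auto
    qed simp
  qed
  also have "\<dots> = card B * card F" by simp
  also have "card B \<le> q"
  proof -
    let ?R = "monom 1 q + [:0, 1:] :: 'k poly"
    have deg: "degree ?R = q"
      using q_ge_2 by (subst degree_add_eq_left) (simp_all add: degree_monom_eq)
    hence "?R \<noteq> 0" using q_ge_2 by auto
    moreover have "B = {x. poly ?R x = 0}"
      by (auto simp: B_def poly_monom eq_neg_iff_add_eq_0)
    ultimately show ?thesis using card_poly_roots_bound deg by metis
  qed
  finally have "q * q \<le> q * card F"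
    by (simp add: card power2_eq_square mult_right_mono)
  thus "q \<le> card F" using q_ge_2 by simp
qed

text \<open>Both sides are monic of degree \<open>q\<close> and vanish at the \<open>q\<close>
  points of \<open>F\<close>; the factor vanishing at \<open>z\<close> is the one indexed by
  \<open>- z\<close>.\<close>

lemma prod_linear_subfield: "(\<Prod>a\<in>F. [:a, 1:]) = P"
proof (rule poly_eqI_degree_lead_coeff[where A = F and n = q])
  have deg: "degree (\<Prod>a\<in>F. [:a, 1:]) = q"
    by (subst degree_prod_eq_sum_degree) (simp_all add: card_subfield)
  show "degree (\<Prod>a\<in>F. [:a, 1:]) \<le> q" using deg by simp
  have "lead_coeff (\<Prod>a\<in>F. [:a, 1:]) = 1"
    by (simp add: lead_coeff_prod)
  moreover have "coeff P q = 1" using q_ge_2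
    by (auto simp: coeff_pCons split: nat.splits)
  ultimately show "coeff (\<Prod>a\<in>F. [:a, 1:]) q = coeff P q"
    using deg by simp
  fix z assume z: "z \<in> F"
  have "- z \<in> F"
    using z diff_power_q[of 0 z] q_ge_2 by (simp add: subfield_of_order_def power_0_left)
  moreover have "poly [:- z, 1:] z = 0" by simp
  ultimately have "poly (\<Prod>a\<in>F. [:a, 1:]) z = 0"
    unfolding poly_prod using prod_zero[of F] by (metis finite)
  moreover have "poly P z = 0" using z by (simp add: subfield_of_order_def poly_monom)
  ultimately show "poly (\<Prod>a\<in>F. [:a, 1:]) z = poly P z" by simp
qed (simp_all add: card_subfield degree_monom_minus_X[OF q_ge_2])

lemma linear_power_q:
  assumes "a \<in> F"
  shows "[:a, 1:] ^ q = [:a, 1:] + P"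
proof -
  have "[:0, 1:] ^ q = (monom 1 q :: 'k poly)"
    by (metis monom_altdef smult_1_left)
  moreover have "[:- a:] ^ q = - [:a ^ q:]"
    using diff_power_q_poly[of 0 "[:a:]"] q_ge_2
    by (simp add: power_0_left poly_const_pow)
  ultimately have "([:0, 1:] - [:- a:]) ^ q = monom 1 q + [:a ^ q:]"
    using diff_power_q_poly[of "[:0, 1:]" "[:- a:]"] by simp
  moreover have "a ^ q = a" using assms by (simp add: subfield_of_order_def)
  ultimately show ?thesis by simp
qed

text \<open>Division-free form of the partial fraction argument: \<open>P ^ (q + 1)\<close> clears
  the denominator \<open>(X + a) ^ (q + 1)\<close>, and one more \<open>P\<close> clears the one
  created by the decomposition.\<close>

lemma sum_linear_powers:
  assumes n: "n + q + 1 = q ^ 3"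
  shows "(\<Sum>a\<in>F. [:a, 1:] ^ n) * P ^ (q + 2) = (P + P ^ q + P ^ (q ^ 2)) * (P - P ^ q) - P ^ 2"
proof -
  define p where "p = P"
  \<comment> \<open>\<open>D a\<close> is the cofactor \<open>P / (X + a)\<close>; \<open>T\<close>
    is what the \<open>q ^ 3\<close>-th power map adds to \<open>X + a\<close>.\<close>
  define D :: "'k \<Rightarrow> 'k poly" where "D = (\<lambda>a. \<Prod>b\<in>F - {a}. [:b, 1:])"
  define T where "T = p + p ^ q + p ^ (q ^ 2)"
  have add_power: "(f + g) ^ q = f ^ q + (g ^ q :: 'k poly)" for f g
    by (rule freshmans_dream'[where n = s]) (use char q in simp_all)
  have char_q: "of_nat q = (0 :: 'k)"
    using s by (simp add: q power_0_left)
  \<comment> \<open>The derivative of \<open>X ^ q\<close> vanishes, while the product rule gives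
    the sum of the cofactors.\<close>
  have "pderiv p = -1"
    by (simp add: p_def pderiv_diff pderiv_monom pderiv_pCons char_q one_pCons)
  moreover have "pderiv p = (\<Sum>a\<in>F. D a)"
    unfolding p_def prod_linear_subfield[symmetric] pderiv_prod D_def
    by (simp add: pderiv_pCons)
  ultimately have sum_D: "(\<Sum>a\<in>F. D a) = -1" by simp
  have "(\<Sum>a\<in>F. D a ^ q) = (\<Sum>a\<in>F. D a) ^ q"
    by (rule freshmans_dream_sum'[where n = s, symmetric]) (use char q in simp_all)
  also have "\<dots> = -1"
    using diff_power_q_poly[of 0 1] q_ge_2 by (simp add: sum_D power_0_left)
  finally have sum_Dq: "(\<Sum>a\<in>F. D a ^ q) = -1" .
  have summand: "[:a, 1:] ^ n * p ^ (q + 2) = p ^ 2 * D a ^ q + T * (p ^ q * D a - p * D a ^ q)"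
    if a: "a \<in> F" for a
  proof -
    define L where "L = [:a, 1:]"
    have p: "p = L * D a"
      using a unfolding p_def prod_linear_subfield[symmetric] D_def L_def
      by (simp add: prod.remove)
    have Lq: "L ^ q = L + p" using linear_power_q[OF a] by (simp add: L_def p_def)
    have Lq2: "L ^ q ^ 2 = L + p + p ^ q"
      by (simp add: power2_eq_square power_mult Lq add_power)
    have "L ^ q ^ 3 = (L ^ q ^ 2) ^ q"
      by (simp add: power_mult[symmetric] power3_eq_cube power2_eq_square)
    also have "\<dots> = L ^ q + p ^ q + (p ^ q) ^ q"
      unfolding Lq2 add_power ..
    also have "\<dots> = L + T"
      by (simp add: Lq T_def power2_eq_square power_mult)
    finally have Lq3: "L ^ q ^ 3 = L + T" .
    \<comment> \<open>This is \<open>1 / (L * L ^ q) = (1 / L - 1 / L ^ q) / p\<close>, multiplied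
      by \<open>p ^ (q + 2)\<close>; it holds because \<open>L ^ q - L = p\<close>.\<close>
    have key: "p * D a ^ (q + 1) = p ^ q * D a - p * D a ^ q"
    proof -
      have "p * D a ^ (q + 1) = (L ^ q - L) * D a ^ (q + 1)" by (simp add: Lq)
      also have "\<dots> = (L * D a) ^ q * D a - (L * D a) * D a ^ q"
        by (simp add: algebra_simps power_mult_distrib)
      finally show ?thesis unfolding p[symmetric] .
    qed
    have "L ^ n * p ^ (q + 2) = L ^ n * (L * D a) ^ (q + 1) * p"
      unfolding p[symmetric] by (simp add: ac_simps)
    also have "\<dots> = L ^ (n + q + 1) * D a ^ (q + 1) * p"
      by (simp only: power_mult_distrib power_add ac_simps)
    also have "\<dots> = p * (L * D a) * D a ^ q + T * (p * D a ^ (q + 1))"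
      unfolding n Lq3 by (simp add: algebra_simps)
    also have "\<dots> = p ^ 2 * D a ^ q + T * (p ^ q * D a - p * D a ^ q)"
      unfolding p[symmetric] key by (simp add: power2_eq_square)
    finally show ?thesis unfolding L_def .
  qed
  have "(\<Sum>a\<in>F. [:a, 1:] ^ n) * p ^ (q + 2) =
      (\<Sum>a\<in>F. p ^ 2 * D a ^ q + T * (p ^ q * D a - p * D a ^ q))"
    unfolding sum_distrib_right by (rule sum.cong[OF refl summand])
  also have "\<dots> = p ^ 2 * (\<Sum>a\<in>F. D a ^ q)
      + T * (p ^ q * (\<Sum>a\<in>F. D a) - p * (\<Sum>a\<in>F. D a ^ q))"
    by (simp only: sum.distrib sum_subtractf sum_distrib_left[symmetric])
  also have "\<dots> = T * (p - p ^ q) - p ^ 2"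
    by (simp add: sum_D sum_Dq algebra_simps)
  finally show ?thesis unfolding T_def p_def .
qed

lemma prime_subfield_diff:
  assumes "x \<in> prime_subfield" "y \<in> (prime_subfield :: 'k set)"
  shows "x - y \<in> prime_subfield"
proof -
  obtain i j where ij: "x = of_nat i" "y = of_nat j"
    using assms by (auto simp: prime_subfield_def)
  \<comment> \<open>This exhibits \<open>-1\<close> as the image of a natural number.\<close>
  have "of_nat (CHAR('k) - 1) = (of_nat CHAR('k) - 1 :: 'k)"
    using prime_gt_0_nat[OF char] by (subst of_nat_diff) auto
  hence "x - y = of_nat (i + (CHAR('k) - 1) * j)"
    by (simp add: ij)
  thus ?thesis unfolding prime_subfield_def by blast
qed

text \<open>Existence follows by cancelling \<open>P ^ (q + 2)\<close>, uniqueness because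
  composition with the nonconstant \<open>P\<close> is injective.\<close>

lemma g_poly_eq:
  assumes n: "n + q + 1 = q ^ 3"
  shows "g_poly n q = monom 1 (q ^ 2 - q - 1) - monom 1 (q ^ 2 - 2) - (monom 1 (q - 2) :: 'k poly)"
    (is "_ = ?g")
  unfolding g_poly_def
proof (rule the_equality)
  have deg: "degree P > 0" using q_ge_2 degree_monom_minus_X[OF q_ge_2, where 'a = 'k] by simp
  hence P0: "P \<noteq> 0" by auto
  have "q * q \<ge> q * 2" using q_ge_2 by (intro mult_left_mono) auto
  \<comment> \<open>This keeps the natural-number subtractions in the exponents from
    truncating.\<close>
  hence le: "q ^ 2 \<ge> q + 2" using q_ge_2 unfolding power2_eq_square by linarith
  have comp_monom: "pcompose (monom 1 i) P = P ^ i" for i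
    by (induction i) (simp_all add: monom_Suc pcompose_pCons monom_0)
  have "pcompose ?g P * P ^ (q + 2) =
      P ^ (q ^ 2 - q - 1 + (q + 2)) - P ^ (q ^ 2 - 2 + (q + 2)) - P ^ (q - 2 + (q + 2))"
    by (simp only: pcompose_diff comp_monom left_diff_distrib power_add)
  also have "q ^ 2 - q - 1 + (q + 2) = q ^ 2 + 1" using le by simp
  also have "q ^ 2 - 2 + (q + 2) = q ^ 2 + q" using le by simp
  also have "q - 2 + (q + 2) = q + q" using q_ge_2 by simp
  also have "P ^ (q ^ 2 + 1) - P ^ (q ^ 2 + q) - P ^ (q + q)
      = (P + P ^ q + P ^ (q ^ 2)) * (P - P ^ q) - P ^ 2"
    unfolding power_add power2_eq_square[of P] power_one_right
    by (simp only: ring_distribs) (simp add: ac_simps)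
  also have "\<dots> = (\<Sum>a\<in>F. [:a, 1:] ^ n) * P ^ (q + 2)"
    using sum_linear_powers[OF n] by simp
  finally have g: "(\<Sum>a\<in>F. [:a, 1:] ^ n) = pcompose ?g P"
    using P0 by simp
  have "(0 :: 'k) \<in> prime_subfield" "(1 :: 'k) \<in> prime_subfield"
    unfolding prime_subfield_def by (metis of_nat_0 rangeI, metis of_nat_1 rangeI)
  hence "coeff ?g i \<in> prime_subfield" for i
    unfolding coeff_diff coeff_monom by (intro prime_subfield_diff) simp_all
  with g show "(\<forall>i. coeff ?g i \<in> prime_subfield) \<and> (\<Sum>a\<in>F. [:a, 1:] ^ n) = pcompose ?g P"
    by blast
  fix g' assume "(\<forall>i. coeff g' i \<in> prime_subfield) \<and> (\<Sum>a\<in>F. [:a, 1:] ^ n) = pcompose g' P"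
  hence "pcompose (g' - ?g) P = 0" using g by (simp only: pcompose_diff) simp
  thus "g' = ?g" using pcompose_eq_0[OF _ deg] by force
qed

end

section \<open>Characteristic two and cube roots of unity\<close>

lemma CHAR_eq_2:
  assumes "CARD('k :: {field, finite}) = 2 ^ m"
  shows "CHAR('k) = 2"
proof -
  \<comment> \<open>Translation by 1 permutes the field, so comparing the sums gives
    \<open>of_nat CARD('k) = 0\<close>.\<close>
  have "(\<Sum>x\<in>UNIV. x :: 'k) = (\<Sum>x\<in>UNIV. x + 1)"
    by (rule sum.reindex_bij_witness[of _ "\<lambda>x. x + 1" "\<lambda>x. x - 1"]) auto
  hence "of_nat (2 ^ m) = (0 :: 'k)" by (simp add: sum.distrib assms[symmetric])
  hence dvd: "CHAR('k) dvd 2 ^ m" by (simp only: of_nat_eq_0_iff_char_dvd)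
  hence "CHAR('k) > 0" by (auto intro: Nat.gr0I)
  hence "prime CHAR('k)" by (rule prime_CHAR_semidom)
  with dvd show ?thesis by (meson prime_dvd_power primes_dvd_imp_eq two_is_prime_nat)
qed

lemma power_2_mod_3: "(2 :: nat) ^ s mod 3 = (if even s then 1 else 2)"
proof (induction s)
  case (Suc s)
  have "2 ^ Suc s mod 3 = 2 * (2 ^ s mod 3) mod (3 :: nat)" by (simp add: mod_mult_right_eq)
  thus ?case using Suc by simp
qed simp

text \<open>Only \<open>m\<close> elements can satisfy \<open>u ^ m = 1\<close>, but
  \<open>3 * m\<close> are nonzero; for any other nonzero \<open>u\<close>, \<open>u ^ m\<close> is
  a cube root of unity different from 1.\<close>

lemma primitive_cube_root_exists:
  assumes "CARD('k :: {field, finite}) = 3 * m + 1" "m > 0"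
  obtains u :: "'k :: {field, finite}" where "u \<noteq> 0" "u ^ m \<noteq> 1" "1 + u ^ m + (u ^ m) ^ 2 = 0"
proof -
  let ?f = "monom 1 m - 1 :: 'k poly"
  have "degree (monom 1 m + (- 1) :: 'k poly) = degree (monom 1 m :: 'k poly)"
    using assms by (intro degree_add_eq_left) (simp add: degree_monom_eq)
  hence deg: "degree ?f = m" by (simp add: degree_monom_eq)
  hence "?f \<noteq> 0" using assms by auto
  hence "card {x. poly ?f x = 0} \<le> m" using card_poly_roots_bound deg by metis
  also have "m < card (UNIV - {0 :: 'k})" using assms by (simp add: card_Diff_singleton)
  finally have "\<not> UNIV - {0 :: 'k} \<subseteq> {x. poly ?f x = 0}"
    using card_mono[of "{x. poly ?f x = 0}" "UNIV - {0 :: 'k}"] by auto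
  then obtain u :: 'k where u: "u \<noteq> 0" "u ^ m \<noteq> 1" by (auto simp: poly_monom)
  have "u * u ^ (3 * m) = u" using finite_field_power_CARD[of u] assms by simp
  hence "(u ^ m) ^ 3 = 1" using u by (simp flip: power_mult add: mult.commute)
  hence "(u ^ m - 1) * (1 + u ^ m + (u ^ m) ^ 2) = 0"
    by (simp add: algebra_simps power2_eq_square power3_eq_cube)
  with u show ?thesis using that by simp
qed

section \<open>Values of \<open>g_poly\<close> and the permutation criterion\<close>

theorem theorem5p9:
  fixes s q n :: nat
  assumes "s \<ge> 1"
    and "q = 2 ^ s"
    and "n = q ^ 3 - q - 1"
    and "CARD('k :: {field, finite}) = q ^ 2"
  shows "(\<forall>x :: 'k.
            (x = 0 \<and> s \<ge> 2 \<longrightarrow> poly (g_poly n q) x = 0) \<and>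
            (x \<noteq> 0 \<longrightarrow> poly (g_poly n q) x = x ^ (q - 2) + quadratic_trace q (inverse x))) \<and>
         (permutation_polynomial (g_poly n q :: 'k poly) \<longleftrightarrow> even s)"
proof -
  define G :: "'k \<Rightarrow> 'k" where "G = poly (g_poly n q)"
  have "CARD('k) = 2 ^ (2 * s)" using assms by (simp add: power_mult mult.commute)
  hence char: "CHAR('k) = 2" by (rule CHAR_eq_2)
  have "(2 :: 'k) = of_nat CHAR('k)" by (simp only: char of_nat_numeral)
  hence two: "(2 :: 'k) = 0" by simp
  have uminus: "- x = x" for x :: 'k
    using two by (metis add.inverse_unique mult_2 mult_zero_left)
  have minus: "x - y = x + y" for x y :: 'k
    using uminus[of y] by (metis diff_conv_add_uminus)
  have q2: "q \<ge> 2" using assms power_increasing[of 1 s "2 :: nat"] by simp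
  have add_q: "(x + y) ^ q = x ^ q + y ^ q" for x y :: 'k
    by (rule freshmans_dream'[where n = s]) (simp_all add: char assms)
  have sq: "q * 2 \<le> q ^ 2" using q2 by (simp add: power2_eq_square)
  have "q * 4 \<le> q ^ 3"
    using mult_mono[OF q2 q2] by (simp add: power3_eq_cube mult.commute)
  hence "n + q + 1 = q ^ 3" using q2 assms by simp
  hence g: "g_poly n q = monom 1 (q ^ 2 - q - 1) - monom 1 (q ^ 2 - 2) - (monom 1 (q - 2) :: 'k poly)"
    by (intro g_poly_eq[where s = s]) (use assms char in simp_all)
  have G: "G x = x ^ (q ^ 2 - q - 1) + x ^ (q ^ 2 - 2) + x ^ (q - 2)" for x
    by (simp add: G_def g poly_monom minus)
  have frob2: "(x ^ q) ^ q = x" for x :: 'k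
    using finite_field_power_CARD[of x] by (simp add: assms power2_eq_square power_mult)
  have fermat: "x ^ (q ^ 2 - 1) = 1" if "x \<noteq> 0" for x :: 'k
  proof -
    have "x * x ^ (q ^ 2 - 1) = x ^ q ^ 2" using q2 by (simp flip: power_Suc)
    also have "\<dots> = x" using finite_field_power_CARD[of x] by (simp add: assms)
    finally show ?thesis using that by simp
  qed
  have G_nz: "G x = x ^ (q - 2) + quadratic_trace q (inverse x)" if "x \<noteq> 0" for x
  proof -
    have "Suc (q ^ 2 - 2) = q ^ 2 - 1" "q ^ 2 - q - 1 + q = q ^ 2 - 1" using sq q2 by linarith+
    hence "x ^ (q ^ 2 - 2) * x = 1" "x ^ (q ^ 2 - q - 1) * x ^ q = 1"
      unfolding power_Suc2[symmetric] power_add[symmetric] using fermat[OF that] by simp_all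
    hence "x ^ (q ^ 2 - 2) = inverse x" "x ^ (q ^ 2 - q - 1) = inverse x ^ q"
      using that by (simp_all add: field_simps)
    thus ?thesis by (simp add: G quadratic_trace_def)
  qed
  \<comment> \<open>For \<open>q = 2\<close> the exponent \<open>q - 2\<close> is 0, and the
    convention \<open>0 ^ 0 = 1\<close> gives \<open>G 0 = 1\<close>.\<close>
  have G_0: "G 0 = 0" if "s \<ge> 2"
  proof -
    have "q \<ge> 4" using that assms power_increasing[of 2 s "2 :: nat"] by simp
    hence "q ^ 2 - q - 1 > 0" "q ^ 2 - 2 > 0" "q - 2 > 0" using sq by linarith+
    thus ?thesis by (simp only: G power_0_left) simp
  qed
  define N :: "'k \<Rightarrow> 'k" where "N = (\<lambda>w. 1 + w + w ^ 2)"
  have G_inv: "G (inverse z) * z ^ (q - 1) = z * N (z ^ (q - 1))" if "z \<noteq> 0" for z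
  proof -
    have "q - 1 = Suc (q - 2)" using q2 by simp
    hence "inverse z ^ (q - 2) * z ^ (q - 1) = inverse z ^ (q - 2) * (z ^ (q - 2) * z)"
      by (simp only: power_Suc2)
    also have "\<dots> = z" using that by (simp add: field_simps)
    finally have "inverse z ^ (q - 2) * z ^ (q - 1) = z" .
    moreover have "z ^ q = z * z ^ (q - 1)" using q2 by (simp flip: power_Suc)
    ultimately show ?thesis using that
      by (simp add: G_nz quadratic_trace_def N_def distrib_right power2_eq_square algebra_simps)
  qed
  have "bij G" if "even s"
  proof -
    have s2: "s \<ge> 2" using that assms(1) by (cases "s = 1") auto
    \<comment> \<open>A \<open>(q - 1)\<close>-th power has norm 1 over the field of order
      \<open>q\<close>.\<close>
    have unity: "w * w ^ q = 1" "w \<noteq> 0" if "z \<noteq> 0" "w = z ^ (q - 1)" for z w :: 'k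
    proof -
      have "w * w ^ q = w ^ (q + 1)" by simp
      also have "\<dots> = z ^ ((q - 1) * (q + 1))" by (simp only: that(2) power_mult)
      also have "(q - 1) * (q + 1) = q ^ 2 - 1" using q2 by (simp add: algebra_simps power2_eq_square)
      finally show "w * w ^ q = 1" using fermat[OF that(1)] by simp
    qed (use that in simp)
    \<comment> \<open>A zero of \<open>N\<close> has \<open>w ^ 3 = 1\<close>; as
      \<open>q mod 3 = 1\<close>, norm 1 then reads \<open>w ^ 2 = 1\<close>. Hence
      \<open>w = 1\<close>, but \<open>N 1 = 3 = 1\<close>.\<close>
    have N_nz: "N w \<noteq> 0" if "w * w ^ q = 1" for w
    proof
      assume N0: "N w = 0"
      have "w ^ 3 - 1 = (w - 1) * N w" by (simp add: N_def algebra_simps power2_eq_square power3_eq_cube)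
      hence w3: "w ^ 3 = 1" using N0 by simp
      have "q mod 3 = 1" using \<open>even s\<close> assms power_2_mod_3[of s] by simp
      then obtain m where "q = 3 * m + 1" by (metis mult_div_mod_eq)
      hence "w * w ^ q = w ^ 2" by (simp add: power_mult w3 power2_eq_square)
      hence "w ^ 2 = 1" using that by simp
      moreover from this w3 have "w = 1" by (simp add: power2_eq_square power3_eq_cube)
      ultimately show False using N0 two by (simp add: N_def)
    qed
    have G_w: "G (inverse z) \<noteq> 0 \<and> G (inverse z) ^ (q - 1) = z ^ (q - 1)" if z: "z \<noteq> 0" for z
    proof -
      define w v where "w = z ^ (q - 1)" and "v = G (inverse z)"
      note w = unity[OF z w_def]
      have v: "v * w = z * N w" using G_inv[OF z] by (simp add: v_def w_def)
      hence v0: "v \<noteq> 0" using z w N_nz[OF w(1)] by auto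
      \<comment> \<open>Frobenius sends \<open>w\<close> to its inverse, and \<open>N\<close> is a
        palindromic polynomial.\<close>
      have "N w ^ q * w ^ 2 = 1 * w ^ 2 + (w * w ^ q) * w + (w * w ^ q) ^ 2"
        by (simp add: N_def add_q power_mult_distrib power2_eq_square algebra_simps)
      also have "\<dots> = N w" using w by (simp add: N_def algebra_simps)
      finally have Nq: "N w ^ q * w ^ 2 = N w" .
      have zq: "z ^ q = z * w" using q2 by (simp add: w_def flip: power_Suc)
      have "v ^ q = v ^ q * w ^ q * w" using w by (simp add: ac_simps)
      also have "\<dots> = z ^ q * N w ^ q * w"
        using v by (metis power_mult_distrib)
      also have "\<dots> = z * (N w ^ q * w ^ 2)"
        by (simp add: zq power2_eq_square ac_simps)
      also have "\<dots> = w * v" unfolding Nq using v by (simp add: ac_simps)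
      finally have "v ^ q = w * v" .
      moreover have "v ^ q = v ^ (q - 1) * v" using q2 by (simp flip: power_Suc2)
      ultimately show ?thesis using v0 by (simp add: v_def w_def)
    qed
    have "x = y" if xy: "G x = G y" for x y
    proof (cases "x = 0 \<or> y = 0")
      case True
      have "G t \<noteq> 0" if "t \<noteq> 0" for t using G_w[of "inverse t"] that by simp
      with True show ?thesis using xy G_0[OF s2] by metis
    next
      case False
      define u z where "u = inverse x" and "z = inverse y"
      have nz: "u \<noteq> 0" "z \<noteq> 0" using False by (simp_all add: u_def z_def)
      have Gu: "G (inverse u) = G (inverse z)" using xy by (simp add: u_def z_def)
      hence eq: "u ^ (q - 1) = z ^ (q - 1)" using G_w[OF nz(1)] G_w[OF nz(2)] by simp
      hence "u * N (z ^ (q - 1)) = z * N (z ^ (q - 1))"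
        using G_inv[OF nz(1)] G_inv[OF nz(2)] Gu by simp
      hence "u = z" using N_nz[OF unity(1)[OF nz(2) refl]] by simp
      thus ?thesis by (simp add: u_def z_def)
    qed
    hence "inj G" by (rule injI)
    thus "bij G" by (simp add: bij_def finite_UNIV_inj_surj)
  qed
  moreover have "\<not> inj G" if "odd s"
  \<comment> \<open>Here \<open>G 0 = 1\<close> when \<open>s = 1\<close>, so the collision is
    between 0 and 1; otherwise a nonzero root of \<open>G\<close> collides with 0.\<close>
  proof (cases "s = 1")
    case True
    hence "G 0 = 1" "G 1 = 1" using two assms by (simp_all add: G)
    thus ?thesis by (metis injD zero_neq_one)
  next
    case False
    have "q mod 3 = 2" using \<open>odd s\<close> assms power_2_mod_3[of s] by simp
    then obtain k where k: "q = 3 * k + 2" by (metis mult_div_mod_eq)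
    \<comment> \<open>Since \<open>q + 1 = 3 * (k + 1)\<close>, this \<open>m\<close> is a third of
      \<open>q ^ 2 - 1\<close>.\<close>
    define m where "m = (k + 1) * (q - 1)"
    have "CARD('k) = 3 * m + 1" "m > 0"
      using k by (simp_all add: assms(4) m_def power2_eq_square algebra_simps)
    then obtain u :: 'k where u: "u \<noteq> 0" "u ^ m \<noteq> 1" "1 + u ^ m + (u ^ m) ^ 2 = 0"
      by (rule primitive_cube_root_exists)
    \<comment> \<open>Chosen so that \<open>z ^ (q - 1)\<close> is the primitive cube root of unity
      \<open>u ^ m\<close>, a zero of \<open>N\<close>.\<close>
    define z where "z = u ^ (k + 1)"
    have z: "z \<noteq> 0" using u by (simp add: z_def)
    have "z ^ (q - 1) = u ^ m" by (simp only: z_def m_def power_mult)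
    hence "G (inverse z) = 0" using G_inv[OF z] u z by (simp add: N_def)
    moreover have "G 0 = 0" using False assms(1) by (intro G_0) simp
    ultimately show ?thesis using z by (metis injD nonzero_imp_inverse_nonzero)
  qed
  ultimately have "bij G \<longleftrightarrow> even s" by (auto simp: bij_def)
  thus ?thesis using G_0 G_nz unfolding permutation_polynomial_def G_def by blast
qed

end
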